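(* Every diffeological group is a fibrant diffeological space.
   Context: A diffeological space is a set $X$ together with, for each $n\in\mathbb{N}$ and each open $U\subseteq\mathbb{R}^n$, a specified set of functions $U\to X$ called plots, such that: every constant map is a plot; if $U\to X$ is a plot and $V\to U$ is a smooth map between open subsets of Euclidean spaces then the composite $V\to X$ is a plot; and a function $U\to X$ whose restriction to each member of some open cover of $U$ is a plot is itself a plot. A map $f:X\to Y$ is smooth if $f\circ p$ is a plot of $Y$ for every plot $p$ of $X$; $C^\infty(X,Y)$ is the set of smooth maps. Products have plots with both components plots. $\mathbb{R}^n$ has as plots the usual smooth maps. A subset $A\subseteq X$ has the sub-diffeology: $U\to A$ is a plot iff $U\to A\hookrightarrow X$ is. A diffeological group is a group object in the category of diffeological spaces, i.e. a diffeological space with a group structure whose multiplication and inversion are smooth. Let $\mathbb{A}^n=\{(x_0,\dots,x_n)\in\mathbb{R}^{n+1}\mid\sum x_i=1\}$ with the sub-diffeology from $\mathbb{R}^{n+1}$. A map $f:\{0,\dots,n\}\to\{0,\dots,m\}$ in the simplicial category induces $f_*:\mathbb{A}^n\to\mathbb{A}^m$, $f_*(x)_j=\sum_{i\in f^{-1}(j)}x_i$. $S^D(X)$ is the simplicial set with $S^D_n(X)=C^\infty(\mathbb{A}^n,X)$ and structure maps given by precomposition. A diffeological space $X$ is fibrant if $S^D(X)$ is a Kan complex. *)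

theory Defs
  imports "HOL-Analysis.Analysis" "HOL-Algebra.Group"
begin

section \<open>Smooth maps between open subsets of Euclidean spaces\<close>

text \<open>
  Dimensions vary inside the definitions below, so $\mathbb{R}^n$ is the library's
  \<^const>\<open>Euclidean_space\<close>: sequences vanishing from index \<open>n\<close> on.
  Maps with a restricted domain are extensional (\<^const>\<open>PiE\<close>), so that
  equality of functions is equality of maps, and are composed with
  \<^const>\<open>compose\<close>.
\<close>

abbreviation Rn :: "nat \<Rightarrow> (nat \<Rightarrow> real) set" where
  "Rn n \<equiv> topspace (Euclidean_space n)"

text \<open>
  \<open>f\<close> is of class \<open>C\<^sup>k\<close> on the open set \<open>U \<subseteq> \<real>\<^sup>n\<close>:
  all iterated partial derivatives up to order \<open>k\<close> exist on \<open>U\<close> and are continuous there.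
  Since \<open>U\<close> is open in \<open>\<real>\<^sup>n\<close>, the derivative at \<open>x \<in> U\<close>
  in a direction \<open>i < n\<close> only sees values of \<open>f\<close> on \<open>U\<close>.
\<close>

primrec C_k_on :: "nat \<Rightarrow> nat \<Rightarrow> (nat \<Rightarrow> real) set \<Rightarrow> ((nat \<Rightarrow> real) \<Rightarrow> real) \<Rightarrow> bool" where
  "C_k_on 0 n U f \<longleftrightarrow> continuous_map (subtopology (Euclidean_space n) U) euclideanreal f"
| "C_k_on (Suc k) n U f \<longleftrightarrow>
     continuous_map (subtopology (Euclidean_space n) U) euclideanreal f \<and>
     (\<forall>i<n. \<exists>f'. (\<forall>x\<in>U. ((\<lambda>t. f (x(i := t))) has_real_derivative f' x) (at (x i))) \<and>
                C_k_on k n U f')"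

definition euclidean_smooth_maps ::
  "nat \<Rightarrow> (nat \<Rightarrow> real) set \<Rightarrow> nat \<Rightarrow> (nat \<Rightarrow> real) set \<Rightarrow> ((nat \<Rightarrow> real) \<Rightarrow> (nat \<Rightarrow> real)) set" where
  "euclidean_smooth_maps n U m V = {f \<in> U \<rightarrow>\<^sub>E V. \<forall>j<m. \<forall>k. C_k_on k n U (\<lambda>x. f x j)}"


section \<open>Diffeological spaces\<close>

text \<open>
  \<open>plots X n U\<close> is the set of plots \<open>U \<rightarrow> X\<close>; it is only meaningful
  (and only ever consulted) for \<open>U\<close> open in \<open>\<real>\<^sup>n\<close>.
\<close>

record 'a diffeology = "'a partial_object" +
  plots :: "nat \<Rightarrow> (nat \<Rightarrow> real) set \<Rightarrow> ((nat \<Rightarrow> real) \<Rightarrow> 'a) set"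

locale diffeological_space =
  fixes X :: "'a diffeology"
  assumes plot_maps:
      "\<And>n U p. \<lbrakk>openin (Euclidean_space n) U; p \<in> plots X n U\<rbrakk> \<Longrightarrow> p \<in> U \<rightarrow>\<^sub>E carrier X"
    and plot_const:
      "\<And>n U x. \<lbrakk>openin (Euclidean_space n) U; x \<in> carrier X\<rbrakk> \<Longrightarrow> (\<lambda>u\<in>U. x) \<in> plots X n U"
    and plot_compose:
      "\<And>n U m V p f. \<lbrakk>openin (Euclidean_space n) U; openin (Euclidean_space m) V;
          p \<in> plots X n U; f \<in> euclidean_smooth_maps m V n U\<rbrakk> \<Longrightarrow> compose V p f \<in> plots X m V"
    and plot_local:
      "\<And>n U p \<V>. \<lbrakk>openin (Euclidean_space n) U; p \<in> U \<rightarrow>\<^sub>E carrier X;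
          \<And>V. V \<in> \<V> \<Longrightarrow> openin (Euclidean_space n) V; \<Union>\<V> = U;
          \<And>V. V \<in> \<V> \<Longrightarrow> restrict p V \<in> plots X n V\<rbrakk> \<Longrightarrow> p \<in> plots X n U"

definition smooth_maps :: "'a diffeology \<Rightarrow> 'b diffeology \<Rightarrow> ('a \<Rightarrow> 'b) set" where
  "smooth_maps X Y = {f \<in> carrier X \<rightarrow>\<^sub>E carrier Y.
     \<forall>n U p. openin (Euclidean_space n) U \<longrightarrow> p \<in> plots X n U \<longrightarrow> compose U f p \<in> plots Y n U}"

definition euclidean_diffeology :: "nat \<Rightarrow> (nat \<Rightarrow> real) diffeology" where
  "euclidean_diffeology m =
     \<lparr>carrier = Rn m, plots = (\<lambda>n U. euclidean_smooth_maps n U m (Rn m))\<rparr>"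

definition sub_diffeology :: "'a diffeology \<Rightarrow> 'a set \<Rightarrow> 'a diffeology" where
  "sub_diffeology X A = \<lparr>carrier = A, plots = (\<lambda>n U. {p \<in> U \<rightarrow>\<^sub>E A. p \<in> plots X n U})\<rparr>"

definition prod_diffeology :: "'a diffeology \<Rightarrow> 'b diffeology \<Rightarrow> ('a \<times> 'b) diffeology" where
  "prod_diffeology X Y =
     \<lparr>carrier = carrier X \<times> carrier Y,
      plots = (\<lambda>n U. {p \<in> U \<rightarrow>\<^sub>E carrier X \<times> carrier Y.
        (\<lambda>u\<in>U. fst (p u)) \<in> plots X n U \<and> (\<lambda>u\<in>U. snd (p u)) \<in> plots Y n U})\<rparr>"

locale diffeological_group = diffeological_space X + group G
  for X :: "'a diffeology" and G :: "('a, 'b) monoid_scheme" (structure) +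
  assumes same_carrier: "carrier X = carrier G"
    and mult_smooth:
      "(\<lambda>(x, y) \<in> carrier G \<times> carrier G. x \<otimes> y) \<in> smooth_maps (prod_diffeology X X) X"
    and inv_smooth: "(\<lambda>x \<in> carrier G. inv x) \<in> smooth_maps X X"


section \<open>Simplicial sets and Kan complexes\<close>

text \<open>Morphisms \<open>[m] \<rightarrow> [n]\<close> of the simplicial category, with \<open>[n] = {0,\<dots>,n}\<close>.\<close>

definition Delta_hom :: "nat \<Rightarrow> nat \<Rightarrow> (nat \<Rightarrow> nat) set" where
  "Delta_hom m n = {f \<in> {..m} \<rightarrow>\<^sub>E {..n}. mono_on {..m} f}"

text \<open>
  For \<open>f : [m] \<rightarrow> [n]\<close>, the structure map \<open>K\<^sub>n \<rightarrow> K\<^sub>m\<close>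
  is \<open>pullback K m n f\<close>.
\<close>

record 'a sset =
  simplices :: "nat \<Rightarrow> 'a set"
  pullback :: "nat \<Rightarrow> nat \<Rightarrow> (nat \<Rightarrow> nat) \<Rightarrow> 'a \<Rightarrow> 'a"

locale simplicial_set =
  fixes K :: "'a sset"
  assumes pullback_closed:
      "\<And>m n f x. \<lbrakk>f \<in> Delta_hom m n; x \<in> simplices K n\<rbrakk> \<Longrightarrow> pullback K m n f x \<in> simplices K m"
    and pullback_id:
      "\<And>n x. x \<in> simplices K n \<Longrightarrow> pullback K n n (\<lambda>i\<in>{..n}. i) x = x"
    and pullback_compose:
      "\<And>l m n f g x. \<lbrakk>f \<in> Delta_hom l m; g \<in> Delta_hom m n; x \<in> simplices K n\<rbrakk> \<Longrightarrow>
          pullback K l n (compose {..l} g f) x = pullback K l m f (pullback K m n g x)"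

definition simplicial_map :: "'a sset \<Rightarrow> 'b sset \<Rightarrow> (nat \<Rightarrow> 'a \<Rightarrow> 'b) \<Rightarrow> bool" where
  "simplicial_map K L \<phi> \<longleftrightarrow>
     (\<forall>n. \<forall>x\<in>simplices K n. \<phi> n x \<in> simplices L n) \<and>
     (\<forall>m n. \<forall>f\<in>Delta_hom m n. \<forall>x\<in>simplices K n.
        \<phi> m (pullback K m n f x) = pullback L m n f (\<phi> n x))"

definition simplex_sset :: "nat \<Rightarrow> (nat \<Rightarrow> nat) sset" where
  "simplex_sset n = \<lparr>simplices = (\<lambda>m. Delta_hom m n), pullback = (\<lambda>l m f a. compose {..l} a f)\<rparr>"

text \<open>
  The horn \<open>\<Lambda>\<^sup>n\<^sub>k\<close> is the union of the faces of \<open>\<Delta>\<^sup>n\<close>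
  opposite to the vertices \<open>j \<noteq> k\<close>; a simplex lies in the \<open>j\<close>-th face
  iff it misses the vertex \<open>j\<close>.
\<close>

definition horn_sset :: "nat \<Rightarrow> nat \<Rightarrow> (nat \<Rightarrow> nat) sset" where
  "horn_sset n k =
     \<lparr>simplices = (\<lambda>m. {a \<in> Delta_hom m n. \<exists>j\<in>{..n} - {k}. j \<notin> a ` {..m}}),
      pullback = (\<lambda>l m f a. compose {..l} a f)\<rparr>"

definition Kan_complex :: "'a sset \<Rightarrow> bool" where
  "Kan_complex K \<longleftrightarrow> simplicial_set K \<and>
     (\<forall>n\<ge>1. \<forall>k\<le>n. \<forall>\<phi>. simplicial_map (horn_sset n k) K \<phi> \<longrightarrow>
        (\<exists>\<psi>. simplicial_map (simplex_sset n) K \<psi> \<and>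
             (\<forall>m. \<forall>a\<in>simplices (horn_sset n k) m. \<psi> m a = \<phi> m a)))"


section \<open>The smooth singular simplicial set\<close>

definition affine_simplex :: "nat \<Rightarrow> (nat \<Rightarrow> real) set" where
  "affine_simplex n = {x \<in> Rn (Suc n). (\<Sum>i\<le>n. x i) = 1}"

definition affine_simplex_diffeology :: "nat \<Rightarrow> (nat \<Rightarrow> real) diffeology" where
  "affine_simplex_diffeology n = sub_diffeology (euclidean_diffeology (Suc n)) (affine_simplex n)"

text \<open>
  The map \<open>f\<^sub>*\<close> on the affine \<open>n\<close>-simplex induced by \<open>f : [n] \<rightarrow> [m]\<close>.
  It vanishes in coordinates \<open>j > m\<close> because these have empty fibres.
\<close>

definition affine_pushforward :: "nat \<Rightarrow> (nat \<Rightarrow> nat) \<Rightarrow> (nat \<Rightarrow> real) \<Rightarrow> (nat \<Rightarrow> real)" where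
  "affine_pushforward n f = (\<lambda>x\<in>affine_simplex n. \<lambda>j. \<Sum>i | i \<le> n \<and> f i = j. x i)"

definition smooth_singular :: "'a diffeology \<Rightarrow> ((nat \<Rightarrow> real) \<Rightarrow> 'a) sset" where
  "smooth_singular X =
     \<lparr>simplices = (\<lambda>n. smooth_maps (affine_simplex_diffeology n) X),
      pullback = (\<lambda>m n f \<sigma>. compose (affine_simplex m) \<sigma> (affine_pushforward m f))\<rparr>"

definition fibrant :: "'a diffeology \<Rightarrow> bool" where
  "fibrant X \<longleftrightarrow> diffeological_space X \<and> Kan_complex (smooth_singular X)"

end

theory Submission
  imports Defs
begin

text \<open>
  Pointwise multiplication makes the smooth maps from any space into a diffeological group
  \<open>G\<close> a group, and precomposition with a smooth map is a homomorphism for it. Hence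
  \<^term>\<open>smooth_singular X\<close> is a simplicial group, and Moore's theorem, that
  simplicial groups are Kan complexes, applies.

  Moore's theorem (\<open>Kan_complex\<close> in the locale \<open>simplicial_group\<close>) is proved by
  correcting one face at a time. For \<open>i \<noteq> k\<close> let \<open>e\<^sub>i : [n] \<rightarrow> [n]\<close>
  move \<open>i\<close> one step towards \<open>k\<close> and fix all other vertices. A map \<open>a\<close>
  into \<open>[n]\<close> misses \<open>i\<close> iff \<open>e\<^sub>i \<circ> a = a\<close>; in particular
  \<open>e\<^sub>i\<close> lies in the horn. If \<open>w \<in> K\<^sub>n\<close> restricts to the given map
  \<open>\<phi>\<close> on the faces opposite to the vertices in \<open>S\<close>, then
  \[ w' = w \cdot (e_i^* w)^{-1} \cdot \phi(e_i) \]
  restricts to \<open>\<phi>\<close> on the face opposite to \<open>i\<close>, and it still does so on the old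
  faces as long as the target \<open>e\<^sub>i(i)\<close> is not in \<open>S\<close>
  (lemma \<open>extend_filler\<close>). Treating the vertices in the order
  \<open>0, \<dots>, k - 1, n, \<dots>, k + 1\<close> meets this condition at every step.

  That \<^term>\<open>smooth_singular X\<close> is a simplicial set at all only needs that the
  induced maps \<open>f\<^sub>*\<close> of affine simplices are smooth. Their coordinates are sums of
  coordinates, so it suffices that smooth functions are closed under finite sums.
\<close>

section \<open>Finite sums of smooth functions\<close>

lemma continuous_map_fun_upd_Euclidean_space:
  assumes "x \<in> Rn n" "i < n"
  shows "continuous_map euclideanreal (Euclidean_space n) (\<lambda>t. x(i := t))"
proof -
  have "continuous_map euclideanreal euclideanreal (\<lambda>t. (x(i := t)) j)" for j
    by (cases "j = i") auto
  then show ?thesis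
    using assms unfolding Euclidean_space_def continuous_map_in_subtopology
      continuous_map_componentwise_UNIV
    by (auto simp: topspace_Euclidean_space)
qed

text \<open>
  For open \<open>U\<close> the property \<^term>\<open>C_k_on k n U f\<close> depends only on the
  restriction of \<open>f\<close> to \<open>U\<close>, because the coordinate lines through a point of
  \<open>U\<close> stay in \<open>U\<close> near that point.
\<close>

lemma C_k_on_cong:
  assumes U: "openin (Euclidean_space n) U" and f: "C_k_on k n U f"
    and eq: "\<And>x. x \<in> U \<Longrightarrow> f x = g x"
  shows "C_k_on k n U g"
proof -
  have cont: "continuous_map (subtopology (Euclidean_space n) U) euclideanreal g"
    if "continuous_map (subtopology (Euclidean_space n) U) euclideanreal f"
    using that by (rule continuous_map_eq) (auto simp: eq)
  have deriv: "((\<lambda>t. g (x(i := t))) has_real_derivative D) (at (x i))"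
    if "((\<lambda>t. f (x(i := t))) has_real_derivative D) (at (x i))" "x \<in> U" "i < n" for x i D
  proof (rule has_field_derivative_transform_within_open[OF that(1)])
    have "x \<in> Rn n"
      using U \<open>x \<in> U\<close> openin_subset by blast
    from continuous_map_fun_upd_Euclidean_space[OF this \<open>i < n\<close>] U
    have "openin euclideanreal {t \<in> topspace euclideanreal. x(i := t) \<in> U}"
      by (rule openin_continuous_map_preimage)
    then show "open {t. x(i := t) \<in> U}"
      by simp
  qed (use \<open>x \<in> U\<close> eq in auto)
  show ?thesis
  proof (cases k)
    case 0
    then show ?thesis using f cont by simp
  next
    case (Suc k')
    with f cont deriv show ?thesis
      unfolding Suc C_k_on.simps by blast
  qed
qed

lemma C_k_on_const: "C_k_on k n U (\<lambda>x. c)"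
proof (induction k arbitrary: c)
  case (Suc k)
  then show ?case
    by (auto intro!: exI[where x = "\<lambda>x. 0"])
qed simp

lemma C_k_on_add:
  assumes "C_k_on k n U f" "C_k_on k n U g"
  shows "C_k_on k n U (\<lambda>x. f x + g x)"
  using assms
proof (induction k arbitrary: f g)
  case 0
  then show ?case by (simp add: continuous_map_add)
next
  case (Suc k)
  have "\<exists>h'. (\<forall>x\<in>U. ((\<lambda>t. f (x(i := t)) + g (x(i := t))) has_real_derivative h' x) (at (x i))) \<and>
          C_k_on k n U h'" if "i < n" for i
  proof -
    obtain f' where f': "\<forall>x\<in>U. ((\<lambda>t. f (x(i := t))) has_real_derivative f' x) (at (x i))"
        "C_k_on k n U f'"
      using Suc.prems(1) \<open>i < n\<close> by auto
    obtain g' where g': "\<forall>x\<in>U. ((\<lambda>t. g (x(i := t))) has_real_derivative g' x) (at (x i))"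
        "C_k_on k n U g'"
      using Suc.prems(2) \<open>i < n\<close> by auto
    show ?thesis
      using f' g' Suc.IH by (intro exI[where x = "\<lambda>x. f' x + g' x"]) (auto intro: DERIV_add)
  qed
  then show ?case
    using Suc.prems by (simp add: continuous_map_add)
qed

lemma C_k_on_sum:
  assumes "finite S" "\<And>i. i \<in> S \<Longrightarrow> C_k_on k n U (f i)"
  shows "C_k_on k n U (\<lambda>x. \<Sum>i\<in>S. f i x)"
  using assms by (induction S rule: finite_induct) (auto simp: C_k_on_const C_k_on_add)


section \<open>The affine simplices\<close>

lemma carrier_affine_simplex_diffeology [simp]:
  "carrier (affine_simplex_diffeology n) = affine_simplex n"
  by (simp add: affine_simplex_diffeology_def sub_diffeology_def)

lemma plots_affine_simplex_diffeology:
  "p \<in> plots (affine_simplex_diffeology n) m U \<longleftrightarrow>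
     p \<in> U \<rightarrow>\<^sub>E affine_simplex n \<and> (\<forall>j\<le>n. \<forall>k. C_k_on k m U (\<lambda>x. p x j))"
  unfolding affine_simplex_diffeology_def sub_diffeology_def euclidean_diffeology_def
    euclidean_smooth_maps_def affine_simplex_def
  by (auto simp: less_Suc_eq_le PiE_def Pi_def)

lemma affine_pushforward_apply:
  "x \<in> affine_simplex m \<Longrightarrow> affine_pushforward m f x j = (\<Sum>i | i \<le> m \<and> f i = j. x i)"
  by (simp add: affine_pushforward_def)

lemma sum_fibres:
  fixes x :: "nat \<Rightarrow> real" and f :: "nat \<Rightarrow> nat"
  assumes "f \<in> {..m} \<rightarrow> {..n}"
  shows "(\<Sum>j | j \<le> n \<and> P j. \<Sum>i | i \<le> m \<and> f i = j. x i) = (\<Sum>i | i \<le> m \<and> P (f i). x i)"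
proof -
  have "(\<Sum>j\<in>{j. j \<le> n \<and> P j}. \<Sum>i\<in>{i \<in> {i. i \<le> m \<and> P (f i)}. f i = j}. x i) =
      (\<Sum>i\<in>{i. i \<le> m \<and> P (f i)}. x i)"
    using assms by (intro sum.group) auto
  moreover have "{i \<in> {i. i \<le> m \<and> P (f i)}. f i = j} = {i. i \<le> m \<and> f i = j}" if "P j" for j
    using that by auto
  ultimately show ?thesis by simp
qed

lemma affine_pushforward_in_affine_simplex:
  assumes f: "f \<in> {..m} \<rightarrow> {..n}" and x: "x \<in> affine_simplex m"
  shows "affine_pushforward m f x \<in> affine_simplex n"
proof -
  have "(\<Sum>i | i \<le> m \<and> f i = j. x i) = 0" if "j \<ge> Suc n" for j
    using f that by (intro sum.neutral) force
  then have "affine_pushforward m f x \<in> Rn (Suc n)"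
    by (simp add: topspace_Euclidean_space affine_pushforward_apply[OF x])
  moreover have "(\<Sum>j\<le>n. affine_pushforward m f x j) = 1"
    using sum_fibres[OF f, where P = "\<lambda>_. True" and x = x] x
    by (simp add: affine_pushforward_apply[OF x] affine_simplex_def flip: atMost_def)
  ultimately show ?thesis
    by (simp add: affine_simplex_def)
qed

lemma affine_pushforward_smooth:
  assumes f: "f \<in> {..m} \<rightarrow> {..n}"
  shows "affine_pushforward m f \<in>
    smooth_maps (affine_simplex_diffeology m) (affine_simplex_diffeology n)"
proof -
  have "compose U (affine_pushforward m f) p \<in> plots (affine_simplex_diffeology n) l U"
    if U: "openin (Euclidean_space l) U" and p: "p \<in> plots (affine_simplex_diffeology m) l U"
    for l U p
  proof -
    have pU: "p x \<in> affine_simplex m" if "x \<in> U" for x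
      using p that by (auto simp: plots_affine_simplex_diffeology)
    have "C_k_on k l U (\<lambda>x. compose U (affine_pushforward m f) p x j)" for j k
    proof (rule C_k_on_cong[OF U])
      show "C_k_on k l U (\<lambda>x. \<Sum>i | i \<le> m \<and> f i = j. p x i)"
        using p by (intro C_k_on_sum) (auto simp: plots_affine_simplex_diffeology)
    qed (simp add: compose_eq affine_pushforward_apply pU)
    then show ?thesis
      using pU affine_pushforward_in_affine_simplex[OF f]
      by (auto simp: plots_affine_simplex_diffeology compose_def)
  qed
  moreover have "affine_pushforward m f \<in> affine_simplex m \<rightarrow>\<^sub>E affine_simplex n"
    using affine_pushforward_in_affine_simplex[OF f]
    by (auto simp: affine_pushforward_def)
  ultimately show ?thesis
    by (simp add: smooth_maps_def)
qed

lemma affine_pushforward_id: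
  assumes "x \<in> affine_simplex n"
  shows "affine_pushforward n (\<lambda>i\<in>{..n}. i) x = x"
proof
  fix j
  have "{i. i \<le> n \<and> (\<lambda>i\<in>{..n}. i) i = j} = (if j \<le> n then {j} else {})"
    by auto
  then show "affine_pushforward n (\<lambda>i\<in>{..n}. i) x j = x j"
    using assms
    by (auto simp: affine_pushforward_apply affine_simplex_def topspace_Euclidean_space)
qed

lemma affine_pushforward_compose:
  assumes f: "f \<in> {..l} \<rightarrow> {..m}" and x: "x \<in> affine_simplex l"
  shows "affine_pushforward l (compose {..l} g f) x =
    affine_pushforward m g (affine_pushforward l f x)"
proof
  fix j
  have "{i. i \<le> l \<and> compose {..l} g f i = j} = {i. i \<le> l \<and> g (f i) = j}"
    by (auto simp: compose_def)
  then show "affine_pushforward l (compose {..l} g f) x j =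
      affine_pushforward m g (affine_pushforward l f x) j"
    using sum_fibres[OF f, where P = "\<lambda>i. g i = j" and x = x]
    by (simp add: affine_pushforward_apply x affine_pushforward_in_affine_simplex[OF f x])
qed


section \<open>The smooth singular simplicial set\<close>

text \<open>
  Here and below, the source of a smooth map is only required to have plots with values in its
  carrier. For the affine simplices this holds by definition, whereas proving that they are
  diffeological spaces would take the chain rule for \<^const>\<open>C_k_on\<close>.
\<close>

lemma smooth_maps_compose:
  assumes f: "f \<in> smooth_maps X Y" and g: "g \<in> smooth_maps Y Z"
    and X: "\<And>n U p. \<lbrakk>openin (Euclidean_space n) U; p \<in> plots X n U\<rbrakk> \<Longrightarrow> p \<in> U \<rightarrow> carrier X"
  shows "compose (carrier X) g f \<in> smooth_maps X Z"
proof -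
  have "compose U (compose (carrier X) g f) p \<in> plots Z n U"
    if U: "openin (Euclidean_space n) U" and p: "p \<in> plots X n U" for n U p
  proof -
    have "compose U g (compose U f p) = compose U (compose (carrier X) g f) p"
      using compose_assoc[OF X[OF U p], of g f] .
    moreover have "compose U g (compose U f p) \<in> plots Z n U"
      using f g U p by (simp add: smooth_maps_def)
    ultimately show ?thesis by simp
  qed
  moreover have "compose (carrier X) g f \<in> carrier X \<rightarrow>\<^sub>E carrier Z"
    using f g by (auto simp: smooth_maps_def compose_def PiE_iff)
  ultimately show ?thesis
    by (simp add: smooth_maps_def)
qed

lemma affine_simplex_plot_maps:
  "p \<in> plots (affine_simplex_diffeology n) m U \<Longrightarrow>
     p \<in> U \<rightarrow> carrier (affine_simplex_diffeology n)"
  by (auto simp: plots_affine_simplex_diffeology)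

lemma Delta_hom_funcset: "f \<in> Delta_hom m n \<Longrightarrow> f \<in> {..m} \<rightarrow> {..n}"
  by (auto simp: Delta_hom_def)

lemma simplicial_set_smooth_singular: "simplicial_set (smooth_singular X)"
proof
  fix m n f \<sigma>
  assume f: "f \<in> Delta_hom m n" and "\<sigma> \<in> simplices (smooth_singular X) n"
  then show "pullback (smooth_singular X) m n f \<sigma> \<in> simplices (smooth_singular X) m"
    using smooth_maps_compose[OF affine_pushforward_smooth[OF Delta_hom_funcset[OF f]],
        of \<sigma> X] affine_simplex_plot_maps
    by (simp add: smooth_singular_def)
next
  fix n \<sigma>
  assume "\<sigma> \<in> simplices (smooth_singular X) n"
  then have "\<sigma> \<in> extensional (affine_simplex n)"
    by (auto simp: smooth_singular_def smooth_maps_def PiE_iff)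
  then show "pullback (smooth_singular X) n n (\<lambda>i\<in>{..n}. i) \<sigma> = \<sigma>"
    by (auto simp: smooth_singular_def compose_def affine_pushforward_id
        intro!: extensionalityI[where A = "affine_simplex n"])
next
  fix l m n f g \<sigma>
  assume f: "f \<in> Delta_hom l m"
  show "pullback (smooth_singular X) l n (compose {..l} g f) \<sigma> =
      pullback (smooth_singular X) l m f (pullback (smooth_singular X) m n g \<sigma>)"
    using Delta_hom_funcset[OF f]
    by (auto simp: smooth_singular_def compose_def affine_pushforward_in_affine_simplex
        affine_pushforward_compose[unfolded compose_def] cong: restrict_cong)
qed


section \<open>Simplicial groups are Kan complexes\<close>

text \<open>A simplicial group: \<open>H n\<close> is the group structure on the \<open>n\<close>-simplices.\<close>

locale simplicial_group = simplicial_set K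
  for K :: "'a sset" and H :: "nat \<Rightarrow> 'a monoid" +
  assumes group_simplices: "\<And>n. group (H n)"
    and carrier_simplices: "\<And>n. carrier (H n) = simplices K n"
    and pullback_hom: "\<And>m n f. f \<in> Delta_hom m n \<Longrightarrow> pullback K m n f \<in> hom (H n) (H m)"

text \<open>The neighbour of \<open>i\<close> on the way to \<open>k\<close>, for \<open>i \<noteq> k\<close>.\<close>

definition step_towards :: "nat \<Rightarrow> nat \<Rightarrow> nat" where
  "step_towards k i = (if i < k then i + 1 else i - 1)"

text \<open>
  \<open>shift_vertex n k i\<close> is the endomorphism of \<open>[n]\<close> that moves the vertex
  \<open>i \<noteq> k\<close> one step towards \<open>k\<close> and fixes all others. It is the composite of
  the coface map missing \<open>i\<close> with a codegeneracy splitting it.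
\<close>

definition shift_vertex :: "nat \<Rightarrow> nat \<Rightarrow> nat \<Rightarrow> nat \<Rightarrow> nat" where
  "shift_vertex n k i = (\<lambda>v\<in>{..n}. if v = i then step_towards k i else v)"

lemma shift_vertex_Delta_hom:
  assumes "k \<le> n" "i \<noteq> k"
  shows "shift_vertex n k i \<in> Delta_hom n n"
  using assms
  by (auto simp: Delta_hom_def shift_vertex_def step_towards_def mono_on_def)

lemma shift_vertex_in_horn:
  assumes "k \<le> n" "i \<le> n" "i \<noteq> k"
  shows "shift_vertex n k i \<in> simplices (horn_sset n k) n"
proof -
  have "i \<notin> shift_vertex n k i ` {..n}"
    using assms by (auto simp: shift_vertex_def step_towards_def split: if_splits)
  then show ?thesis
    using assms shift_vertex_Delta_hom[of k n i] by (auto simp: horn_sset_def)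
qed

lemma compose_shift_vertex_eq:
  assumes "a \<in> Delta_hom m n" "i \<notin> a ` {..m}"
  shows "compose {..m} (shift_vertex n k i) a = a"
proof (rule extensionalityI[where A = "{..m}"])
  show "compose {..m} (shift_vertex n k i) a v = a v" if "v \<in> {..m}" for v
    using assms that by (auto simp: Delta_hom_def shift_vertex_def compose_def)
qed (use assms in \<open>auto simp: Delta_hom_def PiE_iff\<close>)

lemma compose_shift_vertex_misses:
  assumes "a \<in> Delta_hom m n" "j \<notin> a ` {..m}" "step_towards k i \<noteq> j"
  shows "j \<notin> compose {..m} (shift_vertex n k i) a ` {..m}"
  using assms by (auto simp: Delta_hom_def shift_vertex_def compose_def)

lemma Delta_hom_compose:
  "\<lbrakk>f \<in> Delta_hom l m; g \<in> Delta_hom m n\<rbrakk> \<Longrightarrow> compose {..l} g f \<in> Delta_hom l n"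
  by (auto simp: Delta_hom_def mono_on_def compose_def PiE_iff)

context simplicial_group
begin

text \<open>
  \<open>fills n \<phi> S w\<close>: the \<open>n\<close>-simplex \<open>w\<close> restricts to \<open>\<phi>\<close> on the
  faces of \<open>\<Delta>\<^sup>n\<close> opposite to the vertices in \<open>S\<close>.
\<close>

definition fills :: "nat \<Rightarrow> (nat \<Rightarrow> (nat \<Rightarrow> nat) \<Rightarrow> 'a) \<Rightarrow> nat set \<Rightarrow> 'a \<Rightarrow> bool" where
  "fills n \<phi> S w \<longleftrightarrow> w \<in> simplices K n \<and>
     (\<forall>m. \<forall>a\<in>Delta_hom m n. \<forall>j\<in>S. j \<notin> a ` {..m} \<longrightarrow> pullback K m n a w = \<phi> m a)"

lemma extend_filler:
  assumes \<phi>: "simplicial_map (horn_sset n k) K \<phi>" and k: "k \<le> n"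
    and i: "i \<le> n" "i \<noteq> k" and S: "S \<subseteq> {..n} - {k}" "step_towards k i \<notin> S"
    and w: "fills n \<phi> S w"
  shows "\<exists>w'. fills n \<phi> (insert i S) w'"
proof -
  define e where "e = shift_vertex n k i"
  have e: "e \<in> Delta_hom n n" "e \<in> simplices (horn_sset n k) n"
    using shift_vertex_Delta_hom[OF k i(2)] shift_vertex_in_horn[OF k i] by (auto simp: e_def)
  have w_in: "w \<in> simplices K n" and
    w_fills: "\<And>m a j. \<lbrakk>a \<in> Delta_hom m n; j \<in> S; j \<notin> a ` {..m}\<rbrakk> \<Longrightarrow> pullback K m n a w = \<phi> m a"
    using w by (auto simp: fills_def)
  have \<phi>e_in: "\<phi> n e \<in> simplices K n"
    using \<phi> e(2) unfolding simplicial_map_def by blast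
  have ew_in: "pullback K n n e w \<in> simplices K n"
    using pullback_closed[OF e(1) w_in] .
  define w' where
    "w' = w \<otimes>\<^bsub>H n\<^esub> inv\<^bsub>H n\<^esub> (pullback K n n e w) \<otimes>\<^bsub>H n\<^esub> \<phi> n e"
  interpret Hn: group "H n" by (rule group_simplices)
  have w'_in: "w' \<in> simplices K n"
    using w_in \<phi>e_in ew_in unfolding w'_def carrier_simplices[symmetric] by simp
  have "pullback K m n a w' = \<phi> m a"
    if a: "a \<in> Delta_hom m n" and j: "j \<in> insert i S" "j \<notin> a ` {..m}" for m a j
  proof -
    interpret Hm: group "H m" by (rule group_simplices)
    interpret a: group_hom "H n" "H m" "pullback K m n a"
      using pullback_hom[OF a] by unfold_locales
    have ea: "compose {..m} e a \<in> Delta_hom m n"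
      using Delta_hom_compose[OF a e(1)] .
    have "pullback (horn_sset n k) m n a e = compose {..m} e a"
      by (simp add: horn_sset_def)
    then have a_\<phi>e: "pullback K m n a (\<phi> n e) = \<phi> m (compose {..m} e a)"
      using \<phi> a e(2) unfolding simplicial_map_def by metis
    have aw_in: "pullback K m n a w \<in> carrier (H m)"
      using pullback_closed[OF a w_in] by (simp add: carrier_simplices)
    have eaw_in: "pullback K m n (compose {..m} e a) w \<in> carrier (H m)"
      using pullback_closed[OF ea w_in] by (simp add: carrier_simplices)
    have a_w': "pullback K m n a w' = pullback K m n a w
        \<otimes>\<^bsub>H m\<^esub> inv\<^bsub>H m\<^esub> (pullback K m n (compose {..m} e a) w)
        \<otimes>\<^bsub>H m\<^esub> \<phi> m (compose {..m} e a)"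
      using w_in \<phi>e_in ew_in unfolding w'_def carrier_simplices[symmetric]
      by (simp add: a_\<phi>e pullback_compose[OF a e(1) w_in])
    show ?thesis
    proof (cases "i \<in> a ` {..m}")
      case False
      then have "compose {..m} e a = a"
        unfolding e_def by (rule compose_shift_vertex_eq[OF a])
      moreover have "\<phi> m a \<in> carrier (H m)"
        using a_\<phi>e calculation pullback_closed[OF a \<phi>e_in] by (simp add: carrier_simplices)
      ultimately show ?thesis
        using a_w' aw_in by simp
    next
      case True
      with j have "j \<in> S" by auto
      with S have "step_towards k i \<noteq> j" by auto
      then have "j \<notin> compose {..m} e a ` {..m}"
        unfolding e_def by (rule compose_shift_vertex_misses[OF a j(2)])
      \<comment> \<open>Both correction factors have the same restriction along \<open>a\<close>, so they cancel.\<close>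
      then have "\<phi> m (compose {..m} e a) = pullback K m n (compose {..m} e a) w"
        using w_fills[OF ea \<open>j \<in> S\<close>] by simp
      then show ?thesis
        using a_w' aw_in eaw_in w_fills[OF a \<open>j \<in> S\<close> j(2)] by (simp add: Hm.m_assoc)
    qed
  qed
  then have "fills n \<phi> (insert i S) w'"
    using w'_in unfolding fills_def by blast
  then show ?thesis ..
qed

lemma ex_filler:
  assumes \<phi>: "simplicial_map (horn_sset n k) K \<phi>" and k: "k \<le> n"
  shows "\<exists>w. fills n \<phi> ({..n} - {k}) w"
proof -
  have lower: "\<exists>w. fills n \<phi> {..<r} w" if "r \<le> k" for r
    using that
  proof (induction r)
    case 0
    have "\<one>\<^bsub>H n\<^esub> \<in> simplices K n"
      using group.is_monoid[OF group_simplices, THEN monoid.one_closed, of n]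
      by (simp add: carrier_simplices)
    then show ?case
      by (auto simp: fills_def)
  next
    case (Suc r)
    then obtain w where "fills n \<phi> {..<r} w" by auto
    then have "\<exists>w'. fills n \<phi> (insert r {..<r}) w'"
      using Suc.prems k by (intro extend_filler[OF \<phi> k]) (auto simp: step_towards_def)
    then show ?case by (simp add: lessThan_Suc)
  qed
  have "\<exists>w. fills n \<phi> ({..<k} \<union> {n - r<..n}) w" if "r \<le> n - k" for r
    using that
  proof (induction r)
    case 0
    then show ?case using lower[of k] by simp
  next
    case (Suc r)
    then obtain w where "fills n \<phi> ({..<k} \<union> {n - r<..n}) w" by auto
    then have "\<exists>w'. fills n \<phi> (insert (n - r) ({..<k} \<union> {n - r<..n})) w'"
      using Suc.prems k by (intro extend_filler[OF \<phi> k]) (auto simp: step_towards_def)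
    moreover have "insert (n - r) ({..<k} \<union> {n - r<..n}) = {..<k} \<union> {n - Suc r<..n}"
      using Suc.prems by auto
    ultimately show ?case by simp
  qed
  from this[of "n - k"] have "\<exists>w. fills n \<phi> ({..<k} \<union> {k<..n}) w"
    using k by simp
  moreover have "{..<k} \<union> {k<..n} = {..n} - {k}"
    using k by auto
  ultimately show ?thesis by simp
qed

theorem Kan_complex: "Kan_complex K"
proof -
  have "\<exists>\<psi>. simplicial_map (simplex_sset n) K \<psi> \<and>
        (\<forall>m. \<forall>a\<in>simplices (horn_sset n k) m. \<psi> m a = \<phi> m a)"
    if k: "k \<le> n" and \<phi>: "simplicial_map (horn_sset n k) K \<phi>" for n k \<phi>
  proof -
    obtain w where w: "fills n \<phi> ({..n} - {k}) w"
      using ex_filler[OF \<phi> k] by blast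
    then have w_in: "w \<in> simplices K n"
      by (simp add: fills_def)
    have "simplicial_map (simplex_sset n) K (\<lambda>m a. pullback K m n a w)"
      using w_in
      by (auto simp: simplicial_map_def simplex_sset_def pullback_closed pullback_compose)
    moreover have "pullback K m n a w = \<phi> m a" if "a \<in> simplices (horn_sset n k) m" for m a
      using w that unfolding fills_def horn_sset_def by auto
    ultimately show ?thesis by blast
  qed
  then show ?thesis
    using simplicial_set_axioms by (auto simp: Kan_complex_def)
qed

end


section \<open>Smooth maps into a diffeological group\<close>

text \<open>The smooth maps from \<open>Y\<close> to the group \<open>G\<close> on \<open>X\<close>, with pointwise operations.\<close>

definition smooth_maps_group ::
  "'c diffeology \<Rightarrow> 'a diffeology \<Rightarrow> ('a, 'b) monoid_scheme \<Rightarrow> ('c \<Rightarrow> 'a) monoid" where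
  "smooth_maps_group Y X G =
     \<lparr>carrier = smooth_maps Y X,
      mult = (\<lambda>f g. \<lambda>y\<in>carrier Y. f y \<otimes>\<^bsub>G\<^esub> g y),
      one = (\<lambda>y\<in>carrier Y. \<one>\<^bsub>G\<^esub>)\<rparr>"

context diffeological_group
begin

lemma smooth_maps_closed: "\<lbrakk>f \<in> smooth_maps Y X; y \<in> carrier Y\<rbrakk> \<Longrightarrow> f y \<in> carrier G"
  by (auto simp: smooth_maps_def same_carrier)

lemma smooth_maps_mult:
  assumes f: "f \<in> smooth_maps Y X" and g: "g \<in> smooth_maps Y X"
    and Y: "\<And>n U p. \<lbrakk>openin (Euclidean_space n) U; p \<in> plots Y n U\<rbrakk> \<Longrightarrow> p \<in> U \<rightarrow> carrier Y"
  shows "(\<lambda>y\<in>carrier Y. f y \<otimes> g y) \<in> smooth_maps Y X"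
proof -
  let ?h = "\<lambda>y\<in>carrier Y. f y \<otimes> g y"
  have "compose U ?h p \<in> plots X n U"
    if U: "openin (Euclidean_space n) U" and p: "p \<in> plots Y n U" for n U p
  proof -
    have p_in: "p u \<in> carrier Y" if "u \<in> U" for u
      using Y[OF U p] that by auto
    let ?q = "\<lambda>u\<in>U. (f (p u), g (p u))"
    have "compose U f p \<in> plots X n U" "compose U g p \<in> plots X n U"
      using f g U p by (auto simp: smooth_maps_def)
    then have "?q \<in> plots (prod_diffeology X X) n U"
      using p_in smooth_maps_closed[OF f] smooth_maps_closed[OF g]
      by (auto simp: prod_diffeology_def compose_def same_carrier cong: restrict_cong)
    then have "compose U (\<lambda>(x, y) \<in> carrier G \<times> carrier G. x \<otimes> y) ?q \<in> plots X n U"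
      using mult_smooth U by (simp add: smooth_maps_def)
    also have "compose U (\<lambda>(x, y) \<in> carrier G \<times> carrier G. x \<otimes> y) ?q = compose U ?h p"
      using p_in smooth_maps_closed[OF f] smooth_maps_closed[OF g]
      by (auto simp: compose_def cong: restrict_cong)
    finally show ?thesis .
  qed
  then show ?thesis
    using smooth_maps_closed[OF f] smooth_maps_closed[OF g]
    by (auto simp: smooth_maps_def same_carrier)
qed

lemma smooth_maps_one:
  assumes Y: "\<And>n U p. \<lbrakk>openin (Euclidean_space n) U; p \<in> plots Y n U\<rbrakk> \<Longrightarrow> p \<in> U \<rightarrow> carrier Y"
  shows "(\<lambda>y\<in>carrier Y. \<one>) \<in> smooth_maps Y X"
proof -
  have "compose U (\<lambda>y\<in>carrier Y. \<one>) p \<in> plots X n U"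
    if U: "openin (Euclidean_space n) U" and p: "p \<in> plots Y n U" for n U p
  proof -
    have "compose U (\<lambda>y\<in>carrier Y. \<one>) p = (\<lambda>u\<in>U. \<one>)"
      using Y[OF U p] by (auto simp: compose_def Pi_def cong: restrict_cong)
    then show ?thesis
      using plot_const[OF U, of \<one>] by (simp add: same_carrier)
  qed
  then show ?thesis
    by (auto simp: smooth_maps_def same_carrier)
qed

lemma group_smooth_maps_group:
  assumes Y: "\<And>n U p. \<lbrakk>openin (Euclidean_space n) U; p \<in> plots Y n U\<rbrakk> \<Longrightarrow> p \<in> U \<rightarrow> carrier Y"
  shows "group (smooth_maps_group Y X G)"
proof (rule groupI)
  fix f g h
  assume f: "f \<in> carrier (smooth_maps_group Y X G)"
    and g: "g \<in> carrier (smooth_maps_group Y X G)"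
    and h: "h \<in> carrier (smooth_maps_group Y X G)"
  show "f \<otimes>\<^bsub>smooth_maps_group Y X G\<^esub> g \<otimes>\<^bsub>smooth_maps_group Y X G\<^esub> h =
      f \<otimes>\<^bsub>smooth_maps_group Y X G\<^esub> (g \<otimes>\<^bsub>smooth_maps_group Y X G\<^esub> h)"
    using f g h
    by (auto simp: smooth_maps_group_def smooth_maps_closed m_assoc cong: restrict_cong)
next
  fix f
  assume f: "f \<in> carrier (smooth_maps_group Y X G)"
  then have f_smooth: "f \<in> smooth_maps Y X"
    by (simp add: smooth_maps_group_def)
  then have f_ext: "f \<in> extensional (carrier Y)"
    by (auto simp: smooth_maps_def PiE_iff)
  show "\<one>\<^bsub>smooth_maps_group Y X G\<^esub> \<otimes>\<^bsub>smooth_maps_group Y X G\<^esub> f = f"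
    using f_ext
    by (auto simp: smooth_maps_group_def smooth_maps_closed[OF f_smooth]
        intro!: extensionalityI[where A = "carrier Y"])
  have "compose (carrier Y) (\<lambda>x\<in>carrier G. inv x) f \<in> smooth_maps Y X"
    using smooth_maps_compose[OF f_smooth inv_smooth Y] .
  then show "\<exists>g\<in>carrier (smooth_maps_group Y X G).
      g \<otimes>\<^bsub>smooth_maps_group Y X G\<^esub> f = \<one>\<^bsub>smooth_maps_group Y X G\<^esub>"
    by (intro bexI[where x = "compose (carrier Y) (\<lambda>x\<in>carrier G. inv x) f"])
      (auto simp: smooth_maps_group_def compose_def smooth_maps_closed[OF f_smooth]
        cong: restrict_cong)
qed (simp_all add: smooth_maps_group_def smooth_maps_mult[OF _ _ Y] smooth_maps_one[OF Y])

lemma precompose_hom: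
  assumes f: "f \<in> smooth_maps Y Z"
    and Y: "\<And>n U p. \<lbrakk>openin (Euclidean_space n) U; p \<in> plots Y n U\<rbrakk> \<Longrightarrow> p \<in> U \<rightarrow> carrier Y"
  shows "(\<lambda>\<sigma>. compose (carrier Y) \<sigma> f) \<in> hom (smooth_maps_group Z X G) (smooth_maps_group Y X G)"
proof -
  have "f y \<in> carrier Z" if "y \<in> carrier Y" for y
    using f that by (auto simp: smooth_maps_def)
  then show ?thesis
    using smooth_maps_compose[OF f _ Y]
    by (auto simp: hom_def smooth_maps_group_def compose_def cong: restrict_cong)
qed

lemma simplicial_group_smooth_singular:
  "simplicial_group (smooth_singular X)
     (\<lambda>n. smooth_maps_group (affine_simplex_diffeology n) X G)"
proof (intro simplicial_group.intro simplicial_group_axioms.intro)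
  show "simplicial_set (smooth_singular X)"
    by (rule simplicial_set_smooth_singular)
next
  fix n
  show "group (smooth_maps_group (affine_simplex_diffeology n) X G)"
    by (rule group_smooth_maps_group) (rule affine_simplex_plot_maps)
  show "carrier (smooth_maps_group (affine_simplex_diffeology n) X G) =
      simplices (smooth_singular X) n"
    by (simp add: smooth_maps_group_def smooth_singular_def)
next
  fix m n f
  assume "f \<in> Delta_hom m n"
  then show "pullback (smooth_singular X) m n f \<in>
      hom (smooth_maps_group (affine_simplex_diffeology n) X G)
        (smooth_maps_group (affine_simplex_diffeology m) X G)"
    using precompose_hom[OF affine_pushforward_smooth[OF Delta_hom_funcset]
        affine_simplex_plot_maps]
    by (simp add: smooth_singular_def)
qed

end

theorem proposition4p30:
  fixes X :: "'a diffeology" and G :: "('a, 'b) monoid_scheme"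
  assumes "diffeological_group X G"
  shows "fibrant X"
proof -
  interpret diffeological_group X G by (rule assms)
  show ?thesis
    unfolding fibrant_def
    using diffeological_space_axioms
      simplicial_group.Kan_complex[OF simplicial_group_smooth_singular] by simp
qed

end
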